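(* Let $T_1$ be a nonzero contraction and $T_2$ an operator on a Hilbert space $\mathcal{H}$. Suppose $T_1T_2=qT_2T_1$, where $q$ is a complex number satisfying $0<|q|\leq\frac{1}{\|T_1\|}$. Let $V$ on $\mathcal{K}'\supseteq\mathcal{H}$ be the minimal isometric dilation of $T_1$ and let $V_q$ be an operator on $\mathcal{K}\supseteq\mathcal{H}$ such that $qV_q$ is the minimal isometric dilation of $qT_1$. Then there exists a bounded linear operator $W:\mathcal{K}\to\mathcal{K}'$ such that (1) $W^*$ maps $\mathcal{H}$ into $\mathcal{H}$ and $W^*|_{\mathcal{H}}=T_2^*$; (2) $\|W\|=\|T_2\|$; and (3) $VW=qWV_q$.
   Context: All operators are bounded and linear and act on complex Hilbert spaces. A contraction is an operator of norm at most $1$. The minimal isometric dilation of a contraction $T$ on $\mathcal{H}$ is an isometry $V$ on a Hilbert space $\mathcal{K}$ containing $\mathcal{H}$ as a closed subspace such that $T^n=P_{\mathcal{H}}V^n|_{\mathcal{H}}$ for all $n\geq 0$ (where $P_{\mathcal{H}}$ is the orthogonal projection onto $\mathcal{H}$) and $\mathcal{K}$ is the closed linear span of $\{V^nh : h\in\mathcal{H},\ n\geq 0\}$. It is unique up to isomorphism, and $\mathcal{H}$ is invariant under $V^*$ with $V^*|_{\mathcal{H}}=T^*$. *)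

theory Defs
  imports "HOL-Analysis.Analysis"
begin

text \<open>The distribution only has real inner product spaces, so complex vector spaces and complex
  Hilbert spaces are introduced here, on top of the real normed space classes.\<close>

class complex_vector = real_vector +
  fixes scaleC :: "complex \<Rightarrow> 'a \<Rightarrow> 'a" (infixr "*\<^sub>C" 75)
  assumes scaleC_add_right: "c *\<^sub>C (x + y) = c *\<^sub>C x + c *\<^sub>C y"
    and scaleC_add_left: "(c + d) *\<^sub>C x = c *\<^sub>C x + d *\<^sub>C x"
    and scaleC_scaleC: "c *\<^sub>C (d *\<^sub>C x) = (c * d) *\<^sub>C x"
    and scaleC_complex_of_real: "complex_of_real r *\<^sub>C x = r *\<^sub>R x"

lemma vector_space_scaleC:
  "vector_space (scaleC :: complex \<Rightarrow> 'a \<Rightarrow> 'a::complex_vector)"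
proof
  show "1 *\<^sub>C x = x" for x :: 'a
    using scaleC_complex_of_real[of 1 x] by simp
qed (simp_all add: scaleC_add_right scaleC_add_left scaleC_scaleC)

global_interpretation complex_vector: vector_space "scaleC :: complex \<Rightarrow> 'a \<Rightarrow> 'a::complex_vector"
  defines cspan = complex_vector.span
  by (rule vector_space_scaleC)

text \<open>The inner product is linear in its first and conjugate linear in its second argument.
  The class \<^class>\<open>banach\<close> supplies completeness with respect to the norm.\<close>

class complex_hilbert_space = complex_vector + banach +
  fixes cinner :: "'a \<Rightarrow> 'a \<Rightarrow> complex"
  assumes cinner_commute: "cinner x y = cnj (cinner y x)"
    and cinner_add_left: "cinner (x + y) z = cinner x z + cinner y z"
    and cinner_scaleC_left: "cinner (c *\<^sub>C x) y = c * cinner x y"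
    and cinner_ge_zero: "0 \<le> Re (cinner x x)"
    and norm_eq_sqrt_cinner: "norm x = sqrt (Re (cinner x x))"

instantiation complex :: complex_hilbert_space
begin

definition scaleC_complex :: "complex \<Rightarrow> complex \<Rightarrow> complex"
  where "scaleC_complex c x = c * x"

definition cinner_complex :: "complex \<Rightarrow> complex \<Rightarrow> complex"
  where "cinner_complex x y = x * cnj y"

instance
  by standard
    (simp_all add: scaleC_complex_def cinner_complex_def algebra_simps scaleR_conv_of_real
      cmod_def power2_eq_square)

end

text \<open>For a bounded complex linear map the operator norm is the library's \<^const>\<open>onorm\<close>,
  which does not refer to the scalar field.\<close>

definition bounded_clinear ::
    "('a::complex_hilbert_space \<Rightarrow> 'b::complex_hilbert_space) \<Rightarrow> bool"
  where "bounded_clinear T \<longleftrightarrow>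
    Vector_Spaces.linear scaleC scaleC T \<and> (\<exists>M. \<forall>x. norm (T x) \<le> M * norm x)"

definition contraction ::
    "('a::complex_hilbert_space \<Rightarrow> 'b::complex_hilbert_space) \<Rightarrow> bool"
  where "contraction T \<longleftrightarrow> bounded_clinear T \<and> onorm T \<le> 1"

definition linear_isometry ::
    "('a::complex_hilbert_space \<Rightarrow> 'b::complex_hilbert_space) \<Rightarrow> bool"
  where "linear_isometry V \<longleftrightarrow> bounded_clinear V \<and> (\<forall>x. norm (V x) = norm x)"

text \<open>Meaningful for bounded operators, for which such a map exists and is unique.\<close>

definition cadjoint ::
    "('a::complex_hilbert_space \<Rightarrow> 'b::complex_hilbert_space) \<Rightarrow> 'b \<Rightarrow> 'a"
  where "cadjoint T = (THE S. \<forall>x y. cinner (T x) y = cinner x (S y))"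

text \<open>Meaningful for closed complex subspaces.\<close>

definition orthogonal_proj :: "'a::complex_hilbert_space set \<Rightarrow> 'a \<Rightarrow> 'a"
  where "orthogonal_proj S x = (THE y. y \<in> S \<and> (\<forall>z\<in>S. cinner (x - y) z = 0))"

text \<open>The inclusion of \<open>\<H>\<close> in the dilation space \<open>\<K>\<close> is given by a linear isometry
  \<open>\<iota>\<close> between the two types; \<open>\<H>\<close> is identified with the (automatically closed) subspace
  \<open>range \<iota>\<close>.\<close>

definition minimal_isometric_dilation ::
    "('h::complex_hilbert_space \<Rightarrow> 'k::complex_hilbert_space) \<Rightarrow> ('k \<Rightarrow> 'k) \<Rightarrow> ('h \<Rightarrow> 'h) \<Rightarrow> bool"
  where "minimal_isometric_dilation \<iota> V T \<longleftrightarrow>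
    linear_isometry \<iota> \<and>
    linear_isometry V \<and>
    (\<forall>n h. \<iota> ((T ^^ n) h) = orthogonal_proj (range \<iota>) ((V ^^ n) (\<iota> h))) \<and>
    closure (cspan {(V ^^ n) (\<iota> h) |n h. True}) = UNIV"

end

theory Submission
  imports Defs
begin

text \<open>
  The theorem is an instance of commutant lifting.  Write \<open>U\<close> for \<open>q V\<^sub>q\<close> and identify
  \<open>\<H>\<close> with its copies in \<open>\<K>\<close> and \<open>\<K>'\<close>.  Minimality makes \<open>\<H>\<close> invariant under the adjoints of
  both dilations (\<open>minimal_isometric_dilation_coextension\<close>), that is, \<open>P U = q T\<^sub>1 P\<close> and
  \<open>P' V = T\<^sub>1 P'\<close> for the projections \<open>P\<close> and \<open>P'\<close> onto \<open>\<H>\<close>.  Hence \<open>Y = T\<^sub>2 P\<close> intertwines: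
  \<open>T\<^sub>1 Y = T\<^sub>1 T\<^sub>2 P = q T\<^sub>2 T\<^sub>1 P = T\<^sub>2 P U = Y U\<close>.  What is needed is a lift \<open>W : \<K> \<rightarrow> \<K>'\<close>
  with \<open>P' W = Y\<close>, \<open>V W = W U\<close> and \<open>\<parallel>W\<parallel> \<le> \<parallel>T\<^sub>2\<parallel>\<close>.  The equation \<open>P' W = T\<^sub>2 P\<close> says that
  \<open>W\<^sup>*\<close> extends \<open>T\<^sub>2\<^sup>*\<close>, and it gives \<open>\<parallel>T\<^sub>2\<parallel> \<le> \<parallel>W\<parallel>\<close>.

  The lift (\<open>lifting_to_isometric_dilation\<close>) is the strong limit of maps \<open>Z\<^sub>n\<close> of norm at most
  \<open>\<parallel>T\<^sub>2\<parallel>\<close>.  Here \<open>Z\<^sub>0 = Y\<close>, the range of \<open>Z\<^sub>n\<close> lies in that of the \<open>n\<close>-th member \<open>Q\<^sub>n\<close> of an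
  increasing sequence of projections with \<open>Q\<^sub>0 = P'\<close> and \<open>Q\<^sub>n\<^sub>+\<^sub>1 V = V Q\<^sub>n\<close>, and
  \<open>Q\<^sub>n Z\<^sub>n\<^sub>+\<^sub>1 = Z\<^sub>n\<close>, \<open>Z\<^sub>n\<^sub>+\<^sub>1 U = V Z\<^sub>n\<close>.  By Pythagoras the norms \<open>\<parallel>Z\<^sub>n x\<parallel>\<close> increase and control the
  differences \<open>Z\<^sub>m x - Z\<^sub>n x\<close>, so the limit \<open>W\<close> exists, and \<open>Z\<^sub>n\<^sub>+\<^sub>1 U = V Z\<^sub>n\<close> becomes
  \<open>W U = V W\<close>.

  Passing from \<open>Z\<^sub>n\<close> to \<open>Z\<^sub>n\<^sub>+\<^sub>1\<close> (\<open>one_step_lifting\<close>) is a case of Parrott's theorem: one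
  component of the new map is given, and so are its values on the range of \<open>U\<close>.  The missing component has to
  extend a map from the range of \<open>U\<close> while staying bounded by the seminorm
  \<open>(c\<^sup>2 \<parallel>x\<parallel>\<^sup>2 - \<parallel>Z\<^sub>n x\<parallel>\<^sup>2)\<^sup>1\<^sup>/\<^sup>2\<close> with \<open>c = \<parallel>T\<^sub>2\<parallel>\<close>.  Usually this is done with a square root of the defect
  operator.  Here an extension theorem for an arbitrary semi-inner product
  (\<open>contractive_extension\<close>) does it directly.  It rests on an approximate Riesz theorem
  (\<open>approximate_representer\<close>), which also yields the Riesz theorem and the existence of adjoints.
\<close>

section \<open>Semi-inner products\<close>

locale semi_inner_product =
  fixes s :: "'a::complex_vector \<Rightarrow> 'a \<Rightarrow> complex"
  assumes add_left: "s (x + y) z = s x z + s y z"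
    and scaleC_left: "s (c *\<^sub>C x) y = c * s x y"
    and commute: "s x y = cnj (s y x)"
    and nonneg: "0 \<le> Re (s x x)"
begin

lemma minus_left: "s (- x) y = - s x y"
  using scaleC_left[of "-1" x y] by simp

lemma diff_left: "s (x - y) z = s x z - s y z"
  using add_left[of x "- y" z] minus_left[of y z] by simp

lemma add_right: "s x (y + z) = s x y + s x z"
  by (metis add_left commute complex_cnj_add)

lemma diff_right: "s x (y - z) = s x y - s x z"
  by (metis diff_left commute complex_cnj_diff)

lemma scaleC_right: "s x (c *\<^sub>C y) = cnj c * s x y"
  by (metis scaleC_left commute complex_cnj_mult)

lemma Re_add_scaleC:
  "Re (s (x + c *\<^sub>C y) (x + c *\<^sub>C y)) =
    Re (s x x) + 2 * Re (c * s y x) + (cmod c)\<^sup>2 * Re (s y y)"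
proof -
  have "s (x + c *\<^sub>C y) (x + c *\<^sub>C y) =
      s x x + cnj (c * s y x) + c * s y x + (c * cnj c) * s y y"
    using commute[of x y]
    by (simp add: add_left add_right scaleC_left scaleC_right algebra_simps)
  then show ?thesis
    by (simp add: complex_norm_square[symmetric] del: of_real_power)
qed

end

text \<open>The discriminant criterion for a nonnegative quadratic polynomial on the complex plane; it is
  tested at a multiple of \<^term>\<open>cnj w\<close>.\<close>

lemma quadratic_discriminant_bound:
  fixes w :: complex and a e :: real
  assumes q: "\<And>c. 0 \<le> (cmod c)\<^sup>2 * a - 2 * Re (c * w) + e" and "0 \<le> a"
  shows "(cmod w)\<^sup>2 \<le> e * a"
proof -
  have t: "0 \<le> t\<^sup>2 * (cmod w)\<^sup>2 * a - 2 * t * (cmod w)\<^sup>2 + e" for t :: real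
  proof -
    have "Re (of_real t * cnj w * w) = t * (cmod w)\<^sup>2"
      by (simp add: cmod_power2) (simp add: power2_eq_square algebra_simps)
    then show ?thesis
      using q[of "of_real t * cnj w"] by (simp add: norm_mult power_mult_distrib)
  qed
  show ?thesis
  proof (cases "a = 0")
    case True
    show ?thesis
    proof (cases "w = 0")
      case False
      then have "2 * ((e + 1) / (cmod w)\<^sup>2) * (cmod w)\<^sup>2 = 2 * (e + 1)"
        by simp
      moreover have "2 * ((e + 1) / (cmod w)\<^sup>2) * (cmod w)\<^sup>2 \<le> e" "0 \<le> e"
        using t[of "(e + 1) / (cmod w)\<^sup>2"] t[of 0] unfolding True by simp_all
      ultimately have "2 * (e + 1) \<le> e" "0 \<le> e" by metis+
      then show ?thesis by simp
    qed (use True in simp)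
  next
    case False
    with \<open>0 \<le> a\<close> have "0 < a" by simp
    then have "0 \<le> a * ((1/a)\<^sup>2 * (cmod w)\<^sup>2 * a - 2 * (1/a) * (cmod w)\<^sup>2 + e)"
      using t[of "1/a"] by (intro mult_nonneg_nonneg) auto
    also have "\<dots> = e * a - (cmod w)\<^sup>2"
      using \<open>0 < a\<close> by (simp add: field_simps power2_eq_square)
    finally show ?thesis by simp
  qed
qed

context semi_inner_product
begin

lemma Cauchy_Schwarz: "(cmod (s x y))\<^sup>2 \<le> Re (s x x) * Re (s y y)"
proof -
  have "(cmod (s x y))\<^sup>2 \<le> Re (s y y) * Re (s x x)"
  proof (rule quadratic_discriminant_bound)
    show "0 \<le> (cmod c)\<^sup>2 * Re (s x x) - 2 * Re (c * s x y) + Re (s y y)" for c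
      using Re_add_scaleC[of y "- c" x] nonneg[of "y + (- c) *\<^sub>C x"] by simp
  qed (rule nonneg)
  then show ?thesis by (simp add: mult.commute)
qed

text \<open>The Riesz representation theorem up to \<^term>\<open>\<epsilon>\<close>, which needs neither completeness nor
  definiteness: a point that almost minimizes \<^term>\<open>Re (s u u) - 2 * Re (\<phi> u)\<close> almost
  represents \<^term>\<open>\<phi>\<close>.\<close>

lemma approximate_representer:
  assumes add: "\<And>x y. \<phi> (x + y) = \<phi> x + \<phi> y"
    and scale: "\<And>c x. \<phi> (c *\<^sub>C x) = c * \<phi> x"
    and bound: "\<And>x. (cmod (\<phi> x))\<^sup>2 \<le> C * Re (s x x)"
    and "0 < \<epsilon>"
  obtains u where "\<And>v. cmod (\<phi> v - s v u) \<le> \<epsilon> * sqrt (Re (s v v))"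
proof -
  define J where "J u = Re (s u u) - 2 * Re (\<phi> u)" for u
  have low: "- (max C 0) \<le> J u" for u
  proof -
    define r where "r = sqrt (Re (s u u))"
    define d where "d = sqrt (max C 0)"
    have r2: "r\<^sup>2 = Re (s u u)" and d2: "d\<^sup>2 = max C 0"
      by (simp_all add: r_def d_def nonneg)
    have "C * Re (s u u) \<le> max C 0 * Re (s u u)"
      by (intro mult_right_mono nonneg) simp
    with bound[of u] have "(cmod (\<phi> u))\<^sup>2 \<le> (d * r)\<^sup>2"
      by (simp add: power_mult_distrib r2 d2)
    then have "cmod (\<phi> u) \<le> d * r"
      by (rule power2_le_imp_le) (simp add: r_def d_def nonneg)
    then have "Re (\<phi> u) \<le> d * r"
      using complex_Re_le_cmod[of "\<phi> u"] by linarith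
    moreover have "0 \<le> (r - d)\<^sup>2" by simp
    ultimately show ?thesis
      by (simp add: J_def power2_diff r2 d2 algebra_simps)
  qed
  then have bdd: "bdd_below (range J)" by (intro bdd_belowI2)
  obtain u where u: "J u < Inf (range J) + \<epsilon>\<^sup>2"
    using cInf_lessD[of "range J" "Inf (range J) + \<epsilon>\<^sup>2"] \<open>0 < \<epsilon>\<close> by auto
  have "cmod (\<phi> v - s v u) \<le> \<epsilon> * sqrt (Re (s v v))" for v
  proof -
    have "(cmod (\<phi> v - s v u))\<^sup>2 \<le> \<epsilon>\<^sup>2 * Re (s v v)"
    proof (rule quadratic_discriminant_bound)
      fix c
      have "J (u + c *\<^sub>C v) = J u + (cmod c)\<^sup>2 * Re (s v v) - 2 * Re (c * (\<phi> v - s v u))"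
        by (simp add: J_def Re_add_scaleC add scale algebra_simps)
      moreover have "Inf (range J) \<le> J (u + c *\<^sub>C v)"
        by (rule cInf_lower[OF _ bdd]) simp
      ultimately show "0 \<le> (cmod c)\<^sup>2 * Re (s v v) - 2 * Re (c * (\<phi> v - s v u)) + \<epsilon>\<^sup>2"
        using u by linarith
    qed (rule nonneg)
    also have "\<dots> = (\<epsilon> * sqrt (Re (s v v)))\<^sup>2"
      by (simp add: power_mult_distrib nonneg)
    finally show ?thesis
      by (rule power2_le_imp_le) (use \<open>0 < \<epsilon>\<close> nonneg in simp)
  qed
  then show ?thesis by (rule that)
qed

end

text \<open>The one use of completeness common to the Riesz theorem and to the extension theorem below.  The
  limit is independent of the approximations, so that it can be tested on any of them; this
  is how linearity of the extension is checked.\<close>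

lemma limit_of_approximations:
  fixes B :: "'c \<Rightarrow> 'd::banach"
  assumes ex: "\<And>\<epsilon>. 0 < \<epsilon> \<Longrightarrow> \<exists>u. P \<epsilon> u"
    and near: "\<And>\<epsilon> \<delta> u v. P \<epsilon> u \<Longrightarrow> P \<delta> v \<Longrightarrow> norm (B u - B v) \<le> \<epsilon> + \<delta>"
  obtains z where "\<And>\<epsilon> u. P \<epsilon> u \<Longrightarrow> norm (B u - z) \<le> \<epsilon>"
proof -
  have "\<exists>u. P (1 / real (Suc n)) u" for n
    by (rule ex) simp
  then obtain u where u: "\<And>n. P (1 / real (Suc n)) (u n)" by metis
  have "Cauchy (\<lambda>n. B (u n))"
  proof (rule metric_CauchyI)
    fix e :: real assume "0 < e"
    then obtain N where N: "1 / real (Suc N) < e / 2"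
      using nat_approx_posE[of "e/2"] by auto
    have "dist (B (u m)) (B (u n)) < e" if "N \<le> m" "N \<le> n" for m n
    proof -
      have "1 / real (Suc m) \<le> 1 / real (Suc N)" "1 / real (Suc n) \<le> 1 / real (Suc N)"
        using that by (simp_all add: frac_le)
      with near[OF u[of m] u[of n]] N show ?thesis
        unfolding dist_norm by linarith
    qed
    then show "\<exists>M. \<forall>m\<ge>M. \<forall>n\<ge>M. dist (B (u m)) (B (u n)) < e" by blast
  qed
  then obtain z where z: "(\<lambda>n. B (u n)) \<longlonglongrightarrow> z"
    using Cauchy_convergent_iff convergent_def by blast
  have "norm (B v - z) \<le> \<epsilon>" if v: "P \<epsilon> v" for \<epsilon> v
  proof (rule LIMSEQ_le)
    show "(\<lambda>n. norm (B v - B (u n))) \<longlonglongrightarrow> norm (B v - z)"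
      by (intro tendsto_intros z)
    show "(\<lambda>n. \<epsilon> + 1 / real (Suc n)) \<longlonglongrightarrow> \<epsilon>"
      using tendsto_add[OF tendsto_const[of \<epsilon>] LIMSEQ_inverse_real_of_nat]
      by (simp add: inverse_eq_divide)
    show "\<exists>N. \<forall>n\<ge>N. norm (B v - B (u n)) \<le> \<epsilon> + 1 / real (Suc n)"
      using near[OF v u] by blast
  qed
  then show ?thesis by (rule that)
qed

section \<open>Bounded operators between complex Hilbert spaces\<close>

abbreviation clinear :: "('a::complex_vector \<Rightarrow> 'b::complex_vector) \<Rightarrow> bool"
  where "clinear \<equiv> Vector_Spaces.linear scaleC scaleC"

lemma clinear_iff:
  "clinear T \<longleftrightarrow> (\<forall>x y. T (x + y) = T x + T y) \<and> (\<forall>c x. T (c *\<^sub>C x) = c *\<^sub>C T x)"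
  by (simp add: Vector_Spaces.linear_iff vector_space_scaleC)

lemma clinear_add: "clinear T \<Longrightarrow> T (x + y) = T x + T y"
  and clinear_scaleC: "clinear T \<Longrightarrow> T (c *\<^sub>C x) = c *\<^sub>C T x"
  by (simp_all add: clinear_iff)

lemma clinear_diff: "clinear T \<Longrightarrow> T (x - y) = T x - T y"
  using clinear_add[of T "x - y" y] by (simp add: algebra_simps)

interpretation cinner: semi_inner_product "cinner :: 'a::complex_hilbert_space \<Rightarrow> 'a \<Rightarrow> complex"
  by unfold_locales
    (fact cinner_add_left cinner_scaleC_left cinner_commute cinner_ge_zero)+

lemma power2_norm_eq_cinner: "(norm x)\<^sup>2 = Re (cinner x x)"
  for x :: "'a::complex_hilbert_space"
  by (simp add: norm_eq_sqrt_cinner cinner_ge_zero)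

lemma norm_scaleC: "norm (c *\<^sub>C x) = cmod c * norm x"
  for x :: "'a::complex_hilbert_space"
proof -
  have "(norm (c *\<^sub>C x))\<^sup>2 = (cmod c * norm x)\<^sup>2"
    using cinner.Re_add_scaleC[of 0 c x] cinner.diff_left[of x x] cinner.diff_right[of _ x x]
    by (simp add: power2_norm_eq_cinner power_mult_distrib)
  then show ?thesis by (rule power2_eq_imp_eq) simp_all
qed

lemma norm_cinner_le: "cmod (cinner x y) \<le> norm x * norm y"
  for x :: "'a::complex_hilbert_space"
proof (rule power2_le_imp_le)
  show "(cmod (cinner x y))\<^sup>2 \<le> (norm x * norm y)\<^sup>2"
    using cinner.Cauchy_Schwarz by (simp add: power_mult_distrib power2_norm_eq_cinner)
qed simp

lemma cinner_ext:
  fixes y z :: "'a::complex_hilbert_space"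
  assumes "\<And>x. cinner x y = cinner x z"
  shows "y = z"
proof -
  have "cinner (y - z) (y - z) = 0"
    using assms[of "y - z"] by (simp add: cinner.diff_right)
  then have "(norm (y - z))\<^sup>2 = 0" by (simp only: power2_norm_eq_cinner zero_complex.sel)
  then show ?thesis by simp
qed

lemma norm_add_orthogonal:
  fixes x y :: "'a::complex_hilbert_space"
  assumes "cinner x y = 0"
  shows "(norm (x + y))\<^sup>2 = (norm x)\<^sup>2 + (norm y)\<^sup>2"
proof -
  have "cinner y x = 0" using assms cinner_commute[of y x] by simp
  with assms show ?thesis
    by (simp add: power2_norm_eq_cinner cinner.add_left cinner.add_right)
qed

lemma bounded_clinearI:
  assumes "clinear T" "\<And>x. norm (T x) \<le> M * norm x"
  shows "bounded_clinear T"
  using assms unfolding bounded_clinear_def by blast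

lemma bounded_clinear_imp_clinear: "bounded_clinear T \<Longrightarrow> clinear T"
  by (simp add: bounded_clinear_def)

lemma bounded_clinear_imp_bounded_linear:
  assumes "bounded_clinear T"
  shows "bounded_linear T"
proof -
  from assms obtain M where M: "\<And>x. norm (T x) \<le> M * norm x" and T: "clinear T"
    unfolding bounded_clinear_def by blast
  show ?thesis
  proof (rule bounded_linear_intro)
    show "T (r *\<^sub>R x) = r *\<^sub>R T x" for r x
      using clinear_scaleC[OF T] by (simp only: scaleC_complex_of_real[symmetric])
    show "norm (T x) \<le> norm x * M" for x
      using M[of x] by (simp add: mult.commute)
  qed (rule clinear_add[OF T])
qed

lemma norm_le_onorm: "bounded_clinear T \<Longrightarrow> norm (T x) \<le> onorm T * norm x"
  by (rule onorm[OF bounded_clinear_imp_bounded_linear])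

lemma bounded_clinear_tendsto:
  "bounded_clinear T \<Longrightarrow> (f \<longlongrightarrow> a) F \<Longrightarrow> ((\<lambda>x. T (f x)) \<longlongrightarrow> T a) F"
  by (rule bounded_linear.tendsto[OF bounded_clinear_imp_bounded_linear])

lemma bounded_clinear_comp:
  assumes S: "bounded_clinear S" and T: "bounded_clinear T"
  shows "bounded_clinear (\<lambda>x. S (T x))"
proof (rule bounded_clinearI)
  show "clinear (\<lambda>x. S (T x))"
    using S T by (simp add: bounded_clinear_def clinear_iff)
  show "norm (S (T x)) \<le> onorm S * onorm T * norm x" for x
    using norm_le_onorm[OF S, of "T x"] norm_le_onorm[OF T, of x]
      mult_left_mono[OF _ onorm_pos_le[OF bounded_clinear_imp_bounded_linear[OF S]]]
    by (simp add: mult.assoc) (meson order_trans)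
qed

lemma bounded_clinear_scaleC: "bounded_clinear (\<lambda>x::'a::complex_hilbert_space. c *\<^sub>C x)"
proof (rule bounded_clinearI)
  show "clinear (\<lambda>x::'a. c *\<^sub>C x)"
    by (simp add: clinear_iff complex_vector.scale_right_distrib mult.commute)
  show "norm (c *\<^sub>C x) \<le> cmod c * norm x" for x :: 'a
    by (simp add: norm_scaleC)
qed

lemma riesz_representation:
  fixes \<phi> :: "'a::complex_hilbert_space \<Rightarrow> complex"
  assumes "clinear \<phi>" and bound: "\<And>x. cmod (\<phi> x) \<le> M * norm x"
  obtains z where "\<And>x. \<phi> x = cinner x z"
proof -
  have lin: "\<phi> (x + y) = \<phi> x + \<phi> y" "\<phi> (c *\<^sub>C x) = c * \<phi> x" for x y c
    using assms(1) by (simp_all add: clinear_iff scaleC_complex_def)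
  have bound2: "(cmod (\<phi> x))\<^sup>2 \<le> M\<^sup>2 * Re (cinner x x)" for x
    using power_mono[OF bound, of x 2] by (simp add: power_mult_distrib power2_norm_eq_cinner)
  define P where "P \<epsilon> u \<longleftrightarrow> 0 \<le> \<epsilon> \<and> (\<forall>v. cmod (\<phi> v - cinner v u) \<le> \<epsilon> * norm v)" for \<epsilon> u
  have ex: "\<exists>u. P \<epsilon> u" if \<epsilon>: "0 < \<epsilon>" for \<epsilon>
  proof -
    obtain u where "\<And>v. cmod (\<phi> v - cinner v u) \<le> \<epsilon> * sqrt (Re (cinner v v))"
      by (rule cinner.approximate_representer[of \<phi>, OF lin bound2 \<epsilon>]) blast
    then show ?thesis using \<epsilon> unfolding P_def norm_eq_sqrt_cinner by (intro exI[of _ u]) simp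
  qed
  have near: "norm (u - v) \<le> \<epsilon> + \<delta>" if u: "P \<epsilon> u" and v: "P \<delta> v" for \<epsilon> \<delta> u v
  proof -
    define w where "w = u - v"
    have "cinner w w = (\<phi> w - cinner w v) - (\<phi> w - cinner w u)"
      by (simp add: w_def cinner.diff_right)
    then have "(norm w)\<^sup>2 \<le> cmod (\<phi> w - cinner w v) + cmod (\<phi> w - cinner w u)"
      unfolding power2_norm_eq_cinner
      by (metis complex_Re_le_cmod norm_triangle_ineq4 order_trans)
    also have "\<dots> \<le> \<delta> * norm w + \<epsilon> * norm w"
      using u v unfolding P_def by (meson add_mono)
    finally have "norm w * norm w \<le> (\<epsilon> + \<delta>) * norm w"
      by (simp add: power2_eq_square algebra_simps)
    moreover have "0 \<le> \<epsilon> + \<delta>" using u v by (simp add: P_def)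
    ultimately show ?thesis
      unfolding w_def[symmetric] by (cases "norm w = 0") (auto simp: mult_le_cancel_right)
  qed
  obtain z where z: "\<And>\<epsilon> u. P \<epsilon> u \<Longrightarrow> norm (u - z) \<le> \<epsilon>"
    using limit_of_approximations[of P "\<lambda>u. u", OF ex near] by blast
  have "\<phi> x = cinner x z" for x
  proof -
    have "cmod (\<phi> x - cinner x z) \<le> \<epsilon>" if "0 < \<epsilon>" for \<epsilon>
    proof -
      define \<delta> where "\<delta> = \<epsilon> / (2 * norm x + 1)"
      have \<delta>: "0 < \<delta>" and \<delta>_bound: "\<delta> * (2 * norm x) \<le> \<epsilon>"
        using that norm_ge_zero[of x] by (simp_all add: \<delta>_def field_simps add_pos_nonneg)
      obtain u where u: "P \<delta> u" using ex[OF \<delta>] by blast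
      have "\<phi> x - cinner x z = (\<phi> x - cinner x u) + cinner x (u - z)"
        by (simp add: cinner.diff_right)
      then have "cmod (\<phi> x - cinner x z) \<le> \<delta> * norm x + norm x * norm (u - z)"
        using u norm_cinner_le[of x "u - z"] norm_triangle_le add_mono
        unfolding P_def by metis
      also have "\<dots> \<le> \<delta> * norm x + norm x * \<delta>"
        using z[OF u] by (intro add_left_mono mult_left_mono) simp_all
      also have "\<dots> \<le> \<epsilon>" using \<delta>_bound by (simp add: algebra_simps)
      finally show ?thesis .
    qed
    then have "cmod (\<phi> x - cinner x z) \<le> 0"
      using field_le_epsilon[of "cmod (\<phi> x - cinner x z)" 0] by simp
    then show ?thesis by simp
  qed
  then show ?thesis by (rule that)
qed

lemma cadjoint_unique:
  assumes "\<And>x y. cinner (T x) y = cinner x (S y)"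
  shows "cadjoint T = S"
  unfolding cadjoint_def
proof (rule the_equality)
  show "\<forall>x y. cinner (T x) y = cinner x (S y)" using assms by blast
  show "S' = S" if "\<forall>x y. cinner (T x) y = cinner x (S' y)" for S'
    by (rule ext, rule cinner_ext) (use that assms in metis)
qed

lemma cinner_cadjoint:
  assumes "bounded_clinear T"
  shows "cinner (T x) y = cinner x (cadjoint T y)"
proof -
  have "\<exists>z. \<forall>x. cinner (T x) y = cinner x z" for y
  proof -
    have "clinear (\<lambda>x. cinner (T x) y)"
      using assms
      by (simp add: bounded_clinear_def clinear_iff cinner.add_left cinner.scaleC_left
          scaleC_complex_def)
    moreover have "cmod (cinner (T x) y) \<le> (onorm T * norm y) * norm x" for x
      using norm_cinner_le[of "T x" y] mult_right_mono[OF norm_le_onorm[OF assms, of x], of "norm y"]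
      by (simp add: mult_ac)
    ultimately show ?thesis by (meson riesz_representation)
  qed
  then obtain S where S: "\<And>x y. cinner (T x) y = cinner x (S y)" by metis
  then show ?thesis using cadjoint_unique[of T S] by simp
qed

lemma cinner_cadjoint_left:
  assumes "bounded_clinear T"
  shows "cinner (cadjoint T y) x = cinner y (T x)"
  using cinner_cadjoint[OF assms, of x y] cinner_commute[of "cadjoint T y" x]
    cinner_commute[of y "T x"] by simp

lemma bounded_clinear_cadjoint:
  assumes "bounded_clinear T"
  shows "bounded_clinear (cadjoint T)"
proof (rule bounded_clinearI)
  show "clinear (cadjoint T)"
    unfolding clinear_iff
  proof (intro conjI allI)
    show "cadjoint T (x + y) = cadjoint T x + cadjoint T y" for x y
      by (rule cinner_ext)
        (simp add: cinner_cadjoint[OF assms, symmetric] cinner.add_right)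
    show "cadjoint T (c *\<^sub>C x) = c *\<^sub>C cadjoint T x" for c x
      by (rule cinner_ext)
        (simp add: cinner_cadjoint[OF assms, symmetric] cinner.scaleC_right)
  qed
  show "norm (cadjoint T y) \<le> onorm T * norm y" for y
  proof -
    let ?x = "cadjoint T y"
    have "(norm ?x)\<^sup>2 = Re (cinner (T ?x) y)"
      by (simp add: power2_norm_eq_cinner cinner_cadjoint[OF assms])
    also have "\<dots> \<le> norm (T ?x) * norm y"
      by (rule order_trans[OF complex_Re_le_cmod norm_cinner_le])
    also have "\<dots> \<le> onorm T * norm ?x * norm y"
      by (rule mult_right_mono[OF norm_le_onorm[OF assms] norm_ge_zero])
    finally have "norm ?x * norm ?x \<le> (onorm T * norm y) * norm ?x"
      by (simp add: power2_eq_square mult_ac)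
    moreover have "0 \<le> onorm T * norm y"
      using onorm_pos_le[OF bounded_clinear_imp_bounded_linear[OF assms]] by simp
    ultimately show ?thesis
      by (cases "norm ?x = 0") (auto simp: mult_le_cancel_right)
  qed
qed

lemma cinner_isometry:
  assumes "linear_isometry V"
  shows "cinner (V x) (V y) = cinner x y"
proof -
  have V: "clinear V" and n: "\<And>x. norm (V x) = norm x"
    using assms by (auto simp: linear_isometry_def bounded_clinear_def)
  have Re: "Re (cinner (V x) (V y)) = Re (cinner x y)" for x y
  proof -
    have "(norm (V (y + x)))\<^sup>2 = (norm (y + x))\<^sup>2" "(norm (V x))\<^sup>2 = (norm x)\<^sup>2"
      "(norm (V y))\<^sup>2 = (norm y)\<^sup>2"
      by (simp_all only: n)
    then show ?thesis
      using cinner.Re_add_scaleC[of y 1 x] cinner.Re_add_scaleC[of "V y" 1 "V x"]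
      by (simp add: power2_norm_eq_cinner clinear_add[OF V])
  qed
  show ?thesis
  proof (rule complex_eqI)
    show "Im (cinner (V x) (V y)) = Im (cinner x y)"
      using Re[of "\<i> *\<^sub>C x" y] by (simp add: clinear_scaleC[OF V] cinner_scaleC_left)
  qed (rule Re)
qed

lemma cadjoint_isometry:
  assumes "linear_isometry V"
  shows "cadjoint V (V x) = x"
proof (rule cinner_ext)
  show "cinner y (cadjoint V (V x)) = cinner y x" for y
    using assms cinner_cadjoint[of V y "V x"] cinner_isometry[OF assms, of y x]
    by (simp add: linear_isometry_def)
qed

section \<open>Contractive extension\<close>

text \<open>An extension theorem for contractions that does not complete the domain.  In the completion for
  the seminorm of \<open>s\<close>, the map \<open>Z\<close> would be the orthogonal projection onto the closure of the
  range of \<open>U\<close>, followed by the continuous extension of \<open>U x \<mapsto> B x\<close>.  Here the projection of \<open>x\<close> is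
  replaced by vectors \<open>U u\<close> for which \<open>x - U u\<close> is almost orthogonal to the range of \<open>U\<close>.\<close>

lemma (in semi_inner_product) contractive_extension:
  fixes U :: "'c::complex_vector \<Rightarrow> 'a" and B :: "'c \<Rightarrow> 'd::complex_hilbert_space"
  assumes U: "clinear U" and B: "clinear B"
    and B_bound: "\<And>x. (norm (B x))\<^sup>2 \<le> Re (s (U x) (U x))"
  obtains Z where "clinear Z" "\<And>x. Z (U x) = B x"
    "\<And>x. (norm (Z x))\<^sup>2 \<le> Re (s x x)" "\<And>x. Z x \<in> closure (range B)"
proof -
  define r where "r v = sqrt (Re (s (U v) (U v)))" for v
  have r0: "0 \<le> r v" and r2: "(r v)\<^sup>2 = Re (s (U v) (U v))" for v
    by (simp_all add: r_def nonneg)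
  have B_r: "norm (B v) \<le> r v" for v
    unfolding r_def using B_bound by (rule real_le_rsqrt)
  \<comment> \<open>\<open>U u\<close> is the projection of \<open>x\<close> onto the range of \<open>U\<close> up to \<open>\<epsilon>\<close>; tolerance \<open>0\<close> is included because
    \<open>x\<close> itself is an exact solution for \<open>U x\<close>.\<close>
  define P where "P x \<epsilon> u \<longleftrightarrow> 0 \<le> \<epsilon> \<and> (\<forall>v. cmod (s (U v) (x - U u)) \<le> \<epsilon> * r v)" for x \<epsilon> u
  interpret pullback: semi_inner_product "\<lambda>u v. s (U u) (U v)"
    by (unfold_locales; (rule commute)?)
      (simp_all add: clinear_add[OF U] clinear_scaleC[OF U] add_left scaleC_left nonneg)
  have ex: "\<exists>u. P x \<epsilon> u" if \<epsilon>: "0 < \<epsilon>" for x \<epsilon>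
  proof -
    obtain u where "\<And>v. cmod (s (U v) x - s (U v) (U u)) \<le> \<epsilon> * sqrt (Re (s (U v) (U v)))"
    proof (rule pullback.approximate_representer[of "\<lambda>v. s (U v) x" "Re (s x x)" \<epsilon>])
      show "(cmod (s (U v) x))\<^sup>2 \<le> Re (s x x) * Re (s (U v) (U v))" for v
        using Cauchy_Schwarz[of "U v" x] by (simp add: mult.commute)
    qed (use \<epsilon> in \<open>auto simp: clinear_add[OF U] clinear_scaleC[OF U] add_left scaleC_left\<close>)
    then show ?thesis using \<epsilon> unfolding P_def r_def diff_right by (intro exI[of _ u]) simp
  qed
  have near: "norm (B u - B v) \<le> \<epsilon> + \<delta>" if u: "P x \<epsilon> u" and v: "P x \<delta> v" for x \<epsilon> \<delta> u v
  proof -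
    define w where "w = u - v"
    have "s (U w) (U w) = s (U w) (x - U v) - s (U w) (x - U u)"
      unfolding w_def by (simp add: diff_right clinear_diff[OF U])
    then have "Re (s (U w) (U w)) \<le> cmod (s (U w) (x - U v)) + cmod (s (U w) (x - U u))"
      by (metis complex_Re_le_cmod norm_triangle_ineq4 order_trans)
    also have "\<dots> \<le> \<delta> * r w + \<epsilon> * r w"
      using u v unfolding P_def by (meson add_mono)
    finally have "r w * r w \<le> (\<epsilon> + \<delta>) * r w"
      using r2[of w] by (simp add: power2_eq_square algebra_simps)
    moreover have "0 \<le> \<epsilon> + \<delta>" using u v by (simp add: P_def)
    ultimately have "r w \<le> \<epsilon> + \<delta>"
      using r0[of w] by (cases "r w = 0") (auto simp: mult_le_cancel_right)
    then show ?thesis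
      using B_r[of w] unfolding w_def clinear_diff[OF B] by linarith
  qed
  have "\<exists>z. \<forall>\<epsilon> u. P x \<epsilon> u \<longrightarrow> norm (B u - z) \<le> \<epsilon>" for x
    by (rule limit_of_approximations[of "P x" B, OF ex near]) blast+
  then obtain Z where Z: "\<And>x \<epsilon> u. P x \<epsilon> u \<Longrightarrow> norm (B u - Z x) \<le> \<epsilon>" by metis
  have Z_eqI: "Z x = z" if "\<And>\<epsilon>. 0 < \<epsilon> \<Longrightarrow> norm (Z x - z) \<le> K * \<epsilon>" "0 < K" for x z K
  proof -
    have "norm (Z x - z) \<le> 0 + \<epsilon>" if "0 < \<epsilon>" for \<epsilon>
      using that \<open>0 < K\<close> \<open>\<And>\<epsilon>. 0 < \<epsilon> \<Longrightarrow> norm (Z x - z) \<le> K * \<epsilon>\<close>[of "\<epsilon> / K"] by simp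
    then have "norm (Z x - z) \<le> 0" by (rule field_le_epsilon)
    then show ?thesis by simp
  qed
  show ?thesis
  proof
    show "Z (U x) = B x" for x
      using Z[of "U x" 0 x] diff_right[of _ "U x" "U x"] by (simp add: P_def)
    show "clinear Z"
      unfolding clinear_iff
    proof (intro conjI allI)
      fix x y
      show "Z (x + y) = Z x + Z y"
      proof (rule Z_eqI)
        fix \<epsilon> :: real assume \<epsilon>: "0 < \<epsilon>"
        obtain u v where u: "P x \<epsilon> u" and v: "P y \<epsilon> v" using ex[OF \<epsilon>] by metis
        have "P (x + y) (2 * \<epsilon>) (u + v)"
          unfolding P_def
        proof (intro conjI allI)
          fix w
          have "s (U w) (x + y - U (u + v)) = s (U w) (x - U u) + s (U w) (y - U v)"
            by (simp add: clinear_add[OF U] diff_right add_right)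
          moreover have "cmod (s (U w) (x - U u)) \<le> \<epsilon> * r w" "cmod (s (U w) (y - U v)) \<le> \<epsilon> * r w"
            using u v by (simp_all add: P_def)
          ultimately show "cmod (s (U w) (x + y - U (u + v))) \<le> 2 * \<epsilon> * r w"
            using norm_triangle_ineq[of "s (U w) (x - U u)" "s (U w) (y - U v)"] by simp
        qed (use \<epsilon> in simp)
        then have "norm (B (u + v) - Z (x + y)) \<le> 2 * \<epsilon>" by (rule Z)
        moreover have "norm ((B u - Z x) + (B v - Z y)) \<le> 2 * \<epsilon>"
          using Z[OF u] Z[OF v] norm_triangle_ineq[of "B u - Z x" "B v - Z y"] by simp
        ultimately show "norm (Z (x + y) - (Z x + Z y)) \<le> 4 * \<epsilon>"
          using norm_triangle_ineq4[of "(B u - Z x) + (B v - Z y)" "B (u + v) - Z (x + y)"]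
          by (simp add: clinear_add[OF B] algebra_simps)
      qed simp
    next
      fix c x
      show "Z (c *\<^sub>C x) = c *\<^sub>C Z x"
      proof (rule Z_eqI)
        fix \<epsilon> :: real assume \<epsilon>: "0 < \<epsilon>"
        obtain u where u: "P x \<epsilon> u" using ex[OF \<epsilon>] by metis
        have "P (c *\<^sub>C x) (cmod c * \<epsilon>) (c *\<^sub>C u)"
          unfolding P_def
        proof (intro conjI allI)
          fix w
          have "s (U w) (c *\<^sub>C x - U (c *\<^sub>C u)) = cnj c * s (U w) (x - U u)"
            by (simp add: clinear_scaleC[OF U] diff_right scaleC_right right_diff_distrib)
          moreover have "cmod (s (U w) (x - U u)) \<le> \<epsilon> * r w"
            using u by (simp add: P_def)
          ultimately show "cmod (s (U w) (c *\<^sub>C x - U (c *\<^sub>C u))) \<le> cmod c * \<epsilon> * r w"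
            by (simp add: norm_mult mult.assoc mult_left_mono)
        qed (use \<epsilon> in simp)
        then have "norm (c *\<^sub>C B u - Z (c *\<^sub>C x)) \<le> cmod c * \<epsilon>"
          using Z clinear_scaleC[OF B] by metis
        moreover have "norm (c *\<^sub>C B u - c *\<^sub>C Z x) \<le> cmod c * \<epsilon>"
          using Z[OF u] by (simp add: norm_scaleC mult_left_mono
              flip: complex_vector.scale_right_diff_distrib)
        ultimately have "norm (Z (c *\<^sub>C x) - c *\<^sub>C Z x) \<le> 2 * cmod c * \<epsilon>"
          using norm_triangle_ineq4[of "c *\<^sub>C B u - c *\<^sub>C Z x" "c *\<^sub>C B u - Z (c *\<^sub>C x)"] by simp
        then show "norm (Z (c *\<^sub>C x) - c *\<^sub>C Z x) \<le> (2 * cmod c + 1) * \<epsilon>"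
          using \<epsilon> by (simp add: algebra_simps)
      qed (simp add: add_nonneg_pos)
    qed
    fix x
    show "Z x \<in> closure (range B)"
      unfolding closure_approachable
    proof (intro allI impI)
      fix \<epsilon> :: real assume "0 < \<epsilon>"
      then obtain u where "P x (\<epsilon> / 2) u" using ex[of "\<epsilon>/2"] by auto
      then have "dist (B u) (Z x) < \<epsilon>" using Z \<open>0 < \<epsilon>\<close> by (fastforce simp: dist_norm)
      then show "\<exists>y\<in>range B. dist y (Z x) < \<epsilon>" by blast
    qed
    show "(norm (Z x))\<^sup>2 \<le> Re (s x x)"
    proof -
      have "norm (Z x) \<le> 0 + sqrt (Re (s x x))"
      proof (rule field_le_epsilon)
        fix \<epsilon> :: real assume "0 < \<epsilon>"
        then obtain u where u: "P x (\<epsilon> / 3) u" using ex[of "\<epsilon>/3"] by auto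
        have r_bound: "r u \<le> sqrt (Re (s x x)) + 2 * (\<epsilon> / 3)"
        proof (rule ccontr)
          define R where "R = sqrt (Re (s x x))"
          have R: "0 \<le> R" "R\<^sup>2 = Re (s x x)" by (simp_all add: R_def nonneg)
          assume "\<not> ?thesis"
          then have big: "R < r u - 2 * (\<epsilon> / 3)" by (simp add: R_def)
          have "Re (s x x) = Re (s (x - U u) (x - U u)) + 2 * Re (s (U u) (x - U u)) + (r u)\<^sup>2"
            using Re_add_scaleC[of "x - U u" 1 "U u"] by (simp add: r2)
          moreover have "- (\<epsilon> / 3 * r u) \<le> Re (s (U u) (x - U u))"
            using u abs_Re_le_cmod[of "s (U u) (x - U u)"] unfolding P_def by (smt (verit))
          ultimately have "r u * (r u - 2 * (\<epsilon> / 3)) \<le> R * R"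
            using nonneg[of "x - U u"] R(2) by (simp add: algebra_simps power2_eq_square)
          moreover have "R * R < r u * (r u - 2 * (\<epsilon> / 3))"
            using big R(1) \<open>0 < \<epsilon>\<close> by (intro mult_strict_mono') simp_all
          ultimately show False by simp
        qed
        have "norm (Z x) \<le> norm (B u) + norm (B u - Z x)"
          by (metis norm_minus_commute norm_triangle_sub)
        with r_bound B_r[of u] Z[OF u] show "norm (Z x) \<le> 0 + sqrt (Re (s x x)) + \<epsilon>"
          by simp
      qed
      then have "norm (Z x) \<le> sqrt (Re (s x x))" by simp
      from power_mono[OF this norm_ge_zero, of 2] show ?thesis by (simp add: nonneg)
    qed
  qed
qed

section \<open>Towers of projections\<close>

definition orthogonal_projection :: "('a::complex_hilbert_space \<Rightarrow> 'a) \<Rightarrow> bool"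
  where "orthogonal_projection Q \<longleftrightarrow> bounded_clinear Q \<and> (\<forall>x. Q (Q x) = Q x) \<and>
    (\<forall>x y. cinner (Q x) y = cinner x (Q y))"

lemma orthogonal_projectionD:
  assumes "orthogonal_projection Q"
  shows "bounded_clinear Q" "clinear Q" "Q (Q x) = Q x" "cinner (Q x) y = cinner x (Q y)"
  using assms by (auto simp: orthogonal_projection_def bounded_clinear_def)

lemma pythagoras_orthogonal_projection:
  assumes "orthogonal_projection Q" "Q x = x" "Q y = 0"
  shows "(norm (x + y))\<^sup>2 = (norm x)\<^sup>2 + (norm y)\<^sup>2"
proof (rule norm_add_orthogonal)
  show "cinner x y = 0"
    using assms(2,3) orthogonal_projectionD(4)[OF assms(1), of x y] cinner.diff_right[of x y y]
    by simp
qed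

lemma
  assumes Q: "clinear Q" and idem: "\<And>x. Q (Q x) = Q x"
    and symm: "\<And>x y. cinner (Q x) y = cinner x (Q y)"
  shows orthogonal_projectionI: "orthogonal_projection Q"
    and norm_orthogonal_projection_le: "norm (Q x) \<le> norm x"
proof -
  have bound: "norm (Q x) \<le> 1 * norm x" for x
  proof (rule power2_le_imp_le)
    have "cinner (Q x) (x - Q x) = 0"
      by (simp add: symm clinear_diff[OF Q] idem cinner.diff_right)
    from norm_add_orthogonal[OF this] show "(norm (Q x))\<^sup>2 \<le> (1 * norm x)\<^sup>2" by simp
  qed simp
  with bounded_clinearI[OF Q bound] assms show "orthogonal_projection Q"
    unfolding orthogonal_projection_def by blast
  show "norm (Q x) \<le> norm x" using bound by simp
qed

lemma orthogonal_projection_range_isometry: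
  assumes J: "linear_isometry J"
  shows "orthogonal_projection (\<lambda>x. J (cadjoint J x))"
proof (rule orthogonal_projectionI)
  have b: "bounded_clinear J" using J by (simp add: linear_isometry_def)
  show "clinear (\<lambda>x. J (cadjoint J x))"
    by (rule bounded_clinear_imp_clinear[OF
          bounded_clinear_comp[OF b bounded_clinear_cadjoint[OF b]]])
  show "J (cadjoint J (J (cadjoint J x))) = J (cadjoint J x)" for x
    by (simp add: cadjoint_isometry[OF J])
  show "cinner (J (cadjoint J x)) y = cinner x (J (cadjoint J y))" for x y
    by (simp add: cinner_cadjoint[OF b] cinner_cadjoint_left[OF b, symmetric])
qed

lemma norm_cadjoint_isometry_le:
  assumes J: "linear_isometry J"
  shows "norm (cadjoint J x) \<le> norm x"
proof -
  have "norm (J (cadjoint J x)) \<le> norm x"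
    using orthogonal_projectionD[OF orthogonal_projection_range_isometry[OF J]]
    by (intro norm_orthogonal_projection_le[of "\<lambda>x. J (cadjoint J x)"]) auto
  then show ?thesis using J by (simp add: linear_isometry_def)
qed

text \<open>If the kernel of \<open>P\<close> is invariant under the isometry \<open>V\<close>, the \<open>n\<close>-th
  entry is the projection onto the orthogonal complement of the image of this kernel under \<open>V\<^sup>n\<close>, that is,
  \<open>I - V\<^sup>n (I - P) V\<^sup>*\<^sup>n\<close>.  In a minimal dilation this complement is the closed linear span of the
  ranges of \<open>P\<close>, \<open>V P\<close>, \<dots>, \<open>V\<^sup>n P\<close>.\<close>

primrec projection_tower ::
    "('a::complex_hilbert_space \<Rightarrow> 'a) \<Rightarrow> ('a \<Rightarrow> 'a) \<Rightarrow> nat \<Rightarrow> 'a \<Rightarrow> 'a"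
  where
    "projection_tower V P 0 = P"
  | "projection_tower V P (Suc n) =
      (\<lambda>x. x - V (cadjoint V x - projection_tower V P n (cadjoint V x)))"

context
  fixes V P :: "'a::complex_hilbert_space \<Rightarrow> 'a"
  assumes V: "linear_isometry V" and P: "orthogonal_projection P"
    and PV: "\<And>x. P (V (P x)) = P (V x)"
begin

private lemma V_simps: "bounded_clinear V" "clinear V" "clinear (cadjoint V)"
  using V by (auto simp: linear_isometry_def bounded_clinear_imp_clinear bounded_clinear_cadjoint)

lemma projection_tower_shift: "projection_tower V P (Suc n) (V x) = V (projection_tower V P n x)"
  by (simp add: cadjoint_isometry[OF V] clinear_diff[OF V_simps(2)])

lemma orthogonal_projection_tower: "orthogonal_projection (projection_tower V P n)"
proof (induction n)
  case 0
  then show ?case by (simp add: P)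
next
  case (Suc n)
  note Q = orthogonal_projectionD[OF Suc]
  show ?case
  proof (rule orthogonal_projectionI)
    show "clinear (projection_tower V P (Suc n))"
      unfolding clinear_iff
      by (simp add: clinear_diff[OF V_simps(2)] clinear_add[OF V_simps(2)] clinear_add[OF V_simps(3)]
          clinear_add[OF Q(2)] clinear_scaleC[OF V_simps(2)] clinear_scaleC[OF V_simps(3)]
          clinear_scaleC[OF Q(2)] complex_vector.scale_right_diff_distrib)
    show "projection_tower V P (Suc n) (projection_tower V P (Suc n) x) =
        projection_tower V P (Suc n) x" for x
      by (simp add: clinear_diff[OF V_simps(2)] clinear_diff[OF V_simps(3)] clinear_diff[OF Q(2)]
          cadjoint_isometry[OF V] Q(3))
    show "cinner (projection_tower V P (Suc n) x) y = cinner x (projection_tower V P (Suc n) y)"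
      for x y
      by (simp add: cinner.diff_left cinner.diff_right cinner_cadjoint[OF V_simps(1)]
          cinner_cadjoint_left[OF V_simps(1), symmetric] Q(4) clinear_diff[OF V_simps(2)])
  qed
qed

text \<open>The two claims support each other in the induction: the first for \<open>n\<close> gives the second for \<open>n\<close>, and
  the second for \<open>n\<close> gives the first for \<open>n + 1\<close> because \<open>Q\<^sub>n\<^sub>+\<^sub>1 V = V Q\<^sub>n\<close>.\<close>

lemma projection_tower_step:
  "projection_tower V P n (V (projection_tower V P n x)) = projection_tower V P n (V x) \<and>
    projection_tower V P n (projection_tower V P (Suc n) x) = projection_tower V P n x"
proof (induction n arbitrary: x)
  case 0
  show ?case
    by (simp add: PV clinear_diff[OF V_simps(2)] clinear_diff[OF orthogonal_projectionD(2)[OF P]])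
next
  case (Suc n)
  let ?Q = "projection_tower V P"
  have "?Q (Suc n) (V (?Q (Suc n) x)) = ?Q (Suc n) (V x)" for x
    using Suc by (simp only: projection_tower_shift)
  then show ?case
    by (simp add: projection_tower.simps(2)[of V P "Suc n"] del: projection_tower.simps)
      (simp add: clinear_diff[OF V_simps(2)] del: projection_tower.simps
        add: clinear_diff[OF orthogonal_projectionD(2)[OF orthogonal_projection_tower]])
qed

lemma projection_tower_mono:
  assumes "n \<le> m"
  shows "projection_tower V P n (projection_tower V P m x) = projection_tower V P n x"
  using assms
proof (induction m arbitrary: x rule: dec_induct)
  case base
  show ?case by (rule orthogonal_projectionD(3)[OF orthogonal_projection_tower])
next
  case (step m)
  then show ?case using projection_tower_step by metis
qed

lemma projection_tower_mono':
  assumes "n \<le> m"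
  shows "projection_tower V P m (projection_tower V P n x) = projection_tower V P n x"
proof (rule cinner_ext)
  show "cinner y (projection_tower V P m (projection_tower V P n x)) =
      cinner y (projection_tower V P n x)" for y
    by (simp add: orthogonal_projectionD(4)[OF orthogonal_projection_tower, symmetric]
        projection_tower_mono[OF assms])
qed

end

section \<open>Lifting to an isometric dilation\<close>

text \<open>The new map is \<open>Y + D\<close>, where \<open>D\<close> takes values in the kernel of \<open>Q\<close> and has to satisfy
  \<open>D U = V Y - Y U\<close>.  Since \<open>Y U = Q V Y\<close>, the right-hand side is the component of \<open>V Y\<close> in that kernel,
  and Pythagoras shows that it respects the bound \<open>\<parallel>D x\<parallel>\<^sup>2 \<le> c\<^sup>2 \<parallel>x\<parallel>\<^sup>2 - \<parallel>Y x\<parallel>\<^sup>2\<close> on the range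
  of \<open>U\<close>.\<close>

lemma one_step_lifting:
  fixes V :: "'l::complex_hilbert_space \<Rightarrow> 'l" and U :: "'k::complex_hilbert_space \<Rightarrow> 'k"
    and Y :: "'k \<Rightarrow> 'l"
  assumes V: "linear_isometry V" and U: "linear_isometry U"
    and Q: "orthogonal_projection Q" and Q': "orthogonal_projection Q'"
    and QQ': "\<And>x. Q' (Q x) = Q x" and shift: "\<And>x. Q' (V x) = V (Q x)"
    and Y: "clinear Y" and Y_bound: "\<And>x. norm (Y x) \<le> c * norm x"
    and QY: "\<And>x. Q (Y x) = Y x" and QVY: "\<And>x. Q (V (Y x)) = Y (U x)"
  obtains Z where "clinear Z" "\<And>x. norm (Z x) \<le> c * norm x" "\<And>x. Q' (Z x) = Z x"
    "\<And>x. Q (Z x) = Y x" "\<And>x. Z (U x) = V (Y x)"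
proof -
  have V': "clinear V" "\<And>x. norm (V x) = norm x" and U': "clinear U" "\<And>x. norm (U x) = norm x"
    using V U by (auto simp: linear_isometry_def bounded_clinear_def)
  note Qb = orthogonal_projectionD[OF Q] and Q'b = orthogonal_projectionD[OF Q']
  have c: "0 \<le> c * norm x" for x :: 'k
    by (rule order_trans[OF norm_ge_zero Y_bound])
  define s where "s x y = of_real (c\<^sup>2) * cinner x y - cinner (Y x) (Y y)" for x y
  have s_diag: "Re (s x x) = (c * norm x)\<^sup>2 - (norm (Y x))\<^sup>2" for x
    by (simp add: s_def power2_norm_eq_cinner power_mult_distrib flip: of_real_power)
  interpret semi_inner_product s
  proof
    show "s x y = cnj (s y x)" for x y
      unfolding s_def
      by (subst (1 2) cinner_commute) (simp flip: of_real_power)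
    show "0 \<le> Re (s x x)" for x
      unfolding s_diag by (simp add: Y_bound power_mono)
  qed (simp_all add: s_def clinear_add[OF Y] clinear_scaleC[OF Y] cinner.add_left
      cinner.scaleC_left algebra_simps)
  define B where "B x = V (Y x) - Y (U x)" for x
  have QB: "Q (B x) = 0" for x
    by (simp add: B_def clinear_diff[OF Qb(2)] QVY QY)
  have Q'B: "Q' (B x) = B x" for x
    by (simp add: B_def clinear_diff[OF Q'b(2)] shift QY QVY[symmetric] QQ')
  have B_lin: "clinear B"
    using V'(1) U'(1) Y by (simp add: B_def clinear_iff complex_vector.scale_right_diff_distrib)
  have B_bound: "(norm (B x))\<^sup>2 \<le> Re (s (U x) (U x))" for x
  proof -
    \<comment> \<open>\<open>Y (U x) + B x\<close> is \<open>V (Y x)\<close>, whose norm is at most \<open>c * norm x\<close>, which is \<open>c * norm (U x)\<close>.\<close>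
    have "(norm (Y (U x) + B x))\<^sup>2 = (norm (Y (U x)))\<^sup>2 + (norm (B x))\<^sup>2"
      by (rule pythagoras_orthogonal_projection[OF Q QY QB])
    moreover have "(norm (Y (U x) + B x))\<^sup>2 \<le> (c * norm x)\<^sup>2"
      by (simp add: B_def V'(2) Y_bound power_mono)
    ultimately show ?thesis by (simp add: s_diag U'(2))
  qed
  obtain D where D: "clinear D" "\<And>x. D (U x) = B x" "\<And>x. (norm (D x))\<^sup>2 \<le> Re (s x x)"
    "\<And>x. D x \<in> closure (range B)"
    using contractive_extension[OF U'(1) B_lin B_bound] by blast
  \<comment> \<open>Continuous identities valid on the range of \<open>B\<close> pass to the values of \<open>D\<close> by density.\<close>
  have fixed: "T (D x) = T' (D x)"
    if T: "bounded_clinear T" "bounded_clinear T'" "\<And>x. T (B x) = T' (B x)"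
    for x and T T' :: "'l \<Rightarrow> 'l"
  proof -
    obtain f where f: "\<And>n. f n \<in> range B" "f \<longlonglongrightarrow> D x"
      using D(4)[of x] unfolding closure_sequential by blast
    have "T (f n) = T' (f n)" for n using f(1)[of n] T(3) by auto
    with bounded_clinear_tendsto[OF T(1) f(2)] bounded_clinear_tendsto[OF T(2) f(2)]
    show ?thesis by (simp add: LIMSEQ_unique)
  qed
  have id: "bounded_clinear (\<lambda>x::'l. x)" and zero: "bounded_clinear (\<lambda>x::'l. 0::'l)"
    by (auto intro!: bounded_clinearI[of _ 1] simp: clinear_iff)
  have QD: "Q (D x) = 0" for x
    using fixed[OF Qb(1) zero] QB by simp
  have Q'D: "Q' (D x) = D x" for x
    using fixed[OF Q'b(1) id] Q'B by simp
  show ?thesis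
  proof
    show "clinear (\<lambda>x. Y x + D x)"
      using Y D(1) by (simp add: clinear_iff complex_vector.scale_right_distrib)
    show "norm (Y x + D x) \<le> c * norm x" for x
    proof (rule power2_le_imp_le[OF _ c])
      show "(norm (Y x + D x))\<^sup>2 \<le> (c * norm x)\<^sup>2"
        using D(3)[of x] pythagoras_orthogonal_projection[OF Q QY QD] by (simp add: s_diag)
    qed
    show "Q' (Y x + D x) = Y x + D x" for x
      using QQ'[of "Y x"] by (simp add: clinear_add[OF Q'b(2)] QY Q'D)
    show "Q (Y x + D x) = Y x" for x
      by (simp add: clinear_add[OF Qb(2)] QY QD)
    show "Y (U x) + D (U x) = V (Y x)" for x
      by (simp add: D(2) B_def)
  qed
qed

text \<open>The intertwining form of commutant lifting: the hypothesis on \<open>V\<close> says that the range of \<open>J\<close> is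
  invariant under the adjoint of \<open>V\<close>, and \<open>A\<close> is then the compression of \<open>V\<close> to it.\<close>

lemma lifting_to_isometric_dilation:
  fixes V :: "'l::complex_hilbert_space \<Rightarrow> 'l" and U :: "'k::complex_hilbert_space \<Rightarrow> 'k"
    and J :: "'h::complex_hilbert_space \<Rightarrow> 'l" and Y :: "'k \<Rightarrow> 'h"
  assumes V: "linear_isometry V" and U: "linear_isometry U" and J: "linear_isometry J"
    and JV: "\<And>x. cadjoint J (V x) = A (cadjoint J x)"
    and Y: "clinear Y" and Y_bound: "\<And>x. norm (Y x) \<le> c * norm x"
    and AY: "\<And>x. A (Y x) = Y (U x)"
  obtains W where "clinear W" "\<And>x. norm (W x) \<le> c * norm x"
    "\<And>x. cadjoint J (W x) = Y x" "\<And>x. V (W x) = W (U x)"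
proof -
  have J': "bounded_clinear J" "clinear J" "\<And>x. norm (J x) = norm x" and V': "bounded_clinear V"
    using J V by (auto simp: linear_isometry_def bounded_clinear_imp_clinear)
  define P where "P x = J (cadjoint J x)" for x
  define Q where "Q = projection_tower V P"
  have P: "orthogonal_projection P"
    unfolding P_def by (rule orthogonal_projection_range_isometry[OF J])
  have PVP: "P (V (P x)) = P (V x)" for x
    by (simp add: P_def JV cadjoint_isometry[OF J])
  note tower = V P PVP
  have Q: "orthogonal_projection (Q n)" for n
    unfolding Q_def by (rule orthogonal_projection_tower[OF tower])
  \<comment> \<open>The fourth condition, \<open>Q\<^sub>n V Z\<^sub>n = Z\<^sub>n U\<close>, is the compatibility of the two prescriptions that the next map must meet.\<close>
  define adm where "adm n Z \<longleftrightarrow> clinear Z \<and> (\<forall>x. norm (Z x) \<le> c * norm x) \<and>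
      (\<forall>x. Q n (Z x) = Z x) \<and> (\<forall>x. Q n (V (Z x)) = Z (U x)) \<and>
      (n = 0 \<longrightarrow> Z = (\<lambda>x. J (Y x)))" for n and Z :: "'k \<Rightarrow> 'l"
  have "\<exists>Z. \<forall>n. adm n (Z n) \<and>
      ((\<forall>x. Q n (Z (Suc n) x) = Z n x) \<and> (\<forall>x. Z (Suc n) (U x) = V (Z n x)))"
  proof (rule dependent_nat_choice)
    show "\<exists>Z. adm 0 Z"
      using J'(2) Y Y_bound
      by (intro exI[of _ "\<lambda>x. J (Y x)"])
        (simp add: adm_def clinear_iff J'(3) Q_def P_def JV cadjoint_isometry[OF J] AY)
  next
    fix Z n
    assume Z: "adm n Z"
    have shift: "Q (Suc n) (V x) = V (Q n x)" for x
      unfolding Q_def by (rule projection_tower_shift[OF tower])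
    obtain Z' where Z': "clinear Z'" "\<And>x. norm (Z' x) \<le> c * norm x"
      "\<And>x. Q (Suc n) (Z' x) = Z' x" "\<And>x. Q n (Z' x) = Z x" "\<And>x. Z' (U x) = V (Z x)"
    proof (rule one_step_lifting[OF V U Q[of n] Q[of "Suc n"], of Z c])
      show "Q (Suc n) (Q n x) = Q n x" for x
        unfolding Q_def by (rule projection_tower_mono'[OF tower]) simp
    qed (use Z in \<open>auto simp: adm_def shift\<close>)
    then have "adm (Suc n) Z'" by (simp add: adm_def shift)
    with Z' show "\<exists>Z'. adm (Suc n) Z' \<and>
        ((\<forall>x. Q n (Z' x) = Z x) \<and> (\<forall>x. Z' (U x) = V (Z x)))" by blast
  qed
  then obtain Z where adm: "\<And>n. adm n (Z n)" and proj: "\<And>n x. Q n (Z (Suc n) x) = Z n x"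
    and ZU: "\<And>n x. Z (Suc n) (U x) = V (Z n x)" by blast
  have Z_lin: "clinear (Z n)" and Z_bound: "norm (Z n x) \<le> c * norm x" for n x
    using adm by (simp_all add: adm_def)
  have QZ: "Q n (Z m x) = Z n x" if "n \<le> m" for n m x
    using that
  proof (induction m rule: dec_induct)
    case base
    show ?case using adm by (simp add: adm_def)
  next
    case (step m)
    have "Q n (Z (Suc m) x) = Q n (Q m (Z (Suc m) x))"
      unfolding Q_def using projection_tower_mono[OF tower step(1)] by simp
    then show ?case using step by (simp add: proj)
  qed
  have pythagoras: "(norm (Z m x))\<^sup>2 = (norm (Z n x))\<^sup>2 + (norm (Z m x - Z n x))\<^sup>2" if "n \<le> m" for n m x
  proof -
    have "(norm (Z n x + (Z m x - Z n x)))\<^sup>2 = (norm (Z n x))\<^sup>2 + (norm (Z m x - Z n x))\<^sup>2"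
      by (rule pythagoras_orthogonal_projection[OF Q[of n]])
        (simp_all add: clinear_diff[OF orthogonal_projectionD(2)[OF Q]] QZ that)
    then show ?thesis by simp
  qed
  have "convergent (\<lambda>n. Z n x)" for x
  proof -
    let ?a = "\<lambda>n. (norm (Z n x))\<^sup>2"
    have "convergent ?a"
    proof (rule Bseq_mono_convergent)
      show "Bseq ?a"
        by (rule BseqI'[of _ "(c * norm x)\<^sup>2"]) (simp add: Z_bound power_mono)
      show "\<forall>m. \<forall>n\<ge>m. ?a m \<le> ?a n" using pythagoras by simp
    qed
    then have Cauchy: "Cauchy ?a" by (simp add: Cauchy_convergent_iff)
    have "Cauchy (\<lambda>n. Z n x)"
    proof (rule metric_CauchyI)
      fix e :: real assume "0 < e"
      then have "0 < e\<^sup>2" by simp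
      then obtain N where N: "\<And>m n. N \<le> m \<Longrightarrow> N \<le> n \<Longrightarrow> dist (?a m) (?a n) < e\<^sup>2"
        using metric_CauchyD[OF Cauchy] by blast
      have le: "dist (Z m x) (Z n x) < e" if "N \<le> n" "n \<le> m" for m n
      proof (rule power2_less_imp_less)
        show "(dist (Z m x) (Z n x))\<^sup>2 < e\<^sup>2"
          using N[of m n] that pythagoras[OF that(2), of x]
          unfolding dist_norm real_norm_def by linarith
      qed (use \<open>0 < e\<close> in simp)
      have "dist (Z m x) (Z n x) < e" if "N \<le> m" "N \<le> n" for m n
      proof (cases "n \<le> m")
        case False
        then have "dist (Z n x) (Z m x) < e" using that by (intro le) simp_all
        then show ?thesis by (subst dist_commute)
      qed (use le that in blast)
      then show "\<exists>M. \<forall>m\<ge>M. \<forall>n\<ge>M. dist (Z m x) (Z n x) < e" by blast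
    qed
    then show ?thesis by (simp add: Cauchy_convergent_iff)
  qed
  then obtain W where W: "\<And>x. (\<lambda>n. Z n x) \<longlonglongrightarrow> W x"
    unfolding convergent_def by metis
  show ?thesis
  proof
    show "clinear W"
      unfolding clinear_iff
    proof (intro conjI allI)
      show "W (x + y) = W x + W y" for x y
      proof (rule LIMSEQ_unique[OF W])
        show "(\<lambda>n. Z n (x + y)) \<longlonglongrightarrow> W x + W y"
          unfolding clinear_add[OF Z_lin] by (rule tendsto_add[OF W W])
      qed
      show "W (a *\<^sub>C x) = a *\<^sub>C W x" for a x
      proof (rule LIMSEQ_unique[OF W])
        show "(\<lambda>n. Z n (a *\<^sub>C x)) \<longlonglongrightarrow> a *\<^sub>C W x"
          unfolding clinear_scaleC[OF Z_lin]
          by (rule bounded_clinear_tendsto[OF bounded_clinear_scaleC W])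
      qed
    qed
    show "norm (W x) \<le> c * norm x" for x
      by (rule LIMSEQ_le_const2[OF tendsto_norm[OF W]]) (use Z_bound in blast)
    have "cadjoint J (Z n x) = Y x" for n x
    proof -
      have "J (cadjoint J (Z n x)) = J (Y x)"
        using QZ[of 0 n x] adm[of 0] by (simp add: Q_def P_def adm_def)
      from arg_cong[OF this, of "cadjoint J"] show ?thesis
        by (simp only: cadjoint_isometry[OF J])
    qed
    then show "cadjoint J (W x) = Y x" for x
      using bounded_clinear_tendsto[OF bounded_clinear_cadjoint[OF J'(1)] W[of x]]
      by (simp only: LIMSEQ_const_iff)
    show "V (W x) = W (U x)" for x
    proof (rule LIMSEQ_unique)
      show "(\<lambda>n. V (Z n x)) \<longlonglongrightarrow> V (W x)"
        by (rule bounded_clinear_tendsto[OF V' W])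
      show "(\<lambda>n. V (Z n x)) \<longlonglongrightarrow> W (U x)"
        using LIMSEQ_Suc[OF W[of "U x"]] by (simp only: ZU)
    qed
  qed
qed

section \<open>Minimal isometric dilations\<close>

lemma orthogonal_proj_range_isometry:
  assumes J: "linear_isometry J"
  shows "orthogonal_proj (range J) x = J (cadjoint J x)"
  unfolding orthogonal_proj_def
proof (rule the_equality)
  have b: "bounded_clinear J" using J by (simp add: linear_isometry_def)
  have eq: "cinner (x - J h) (J k) = cinner (cadjoint J x - h) k" for h k
    by (simp add: cinner.diff_left cinner_cadjoint_left[OF b] cinner_isometry[OF J])
  have zero: "cinner 0 z = 0" for z :: 'a
    using cinner.diff_left[of z z z] by simp
  show "J (cadjoint J x) \<in> range J \<and> (\<forall>z\<in>range J. cinner (x - J (cadjoint J x)) z = 0)"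
    by (auto simp: eq zero)
  show "y = J (cadjoint J x)" if "y \<in> range J \<and> (\<forall>z\<in>range J. cinner (x - y) z = 0)" for y
  proof -
    from that obtain h where y: "y = J h" and "\<forall>k. cinner (cadjoint J x - h) k = 0"
      by (auto simp: eq)
    then have "(norm (cadjoint J x - h))\<^sup>2 = 0"
      by (simp add: power2_norm_eq_cinner)
    then show ?thesis by (simp add: y)
  qed
qed

text \<open>This is where minimality enters.  The dilation property gives the equation on
  the vectors \<open>V\<^sup>n h\<close>, since both sides are \<open>T\<^sup>n\<^sup>+\<^sup>1 h\<close> there, and these vectors span a dense subspace.
  Taking adjoints, it says that the adjoint of \<open>V\<close> extends that of \<open>T\<close>.\<close>

lemma minimal_isometric_dilation_coextension:
  assumes dil: "minimal_isometric_dilation J V T" and T: "bounded_clinear T"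
  shows "cadjoint J (V x) = T (cadjoint J x)"
proof -
  have J: "linear_isometry J" and V: "linear_isometry V"
    and pow: "\<And>n h. J ((T ^^ n) h) = orthogonal_proj (range J) ((V ^^ n) (J h))"
    and dense: "closure (cspan {(V ^^ n) (J h) |n h. True}) = UNIV"
    using dil by (auto simp: minimal_isometric_dilation_def)
  have J': "bounded_clinear (cadjoint J)" and V': "bounded_clinear V"
    using J V by (simp_all add: linear_isometry_def bounded_clinear_cadjoint)
  have pow': "cadjoint J ((V ^^ n) (J h)) = (T ^^ n) h" for n h
    using arg_cong[OF pow[of n h], of "cadjoint J"]
    by (simp add: orthogonal_proj_range_isometry[OF J] cadjoint_isometry[OF J])
  let ?D = "{(V ^^ n) (J h) |n h. True}"
  note lin = bounded_clinear_imp_clinear[OF V'] bounded_clinear_imp_clinear[OF J']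
    bounded_clinear_imp_clinear[OF T]
  have span: "cadjoint J (V y) = T (cadjoint J y)" if "y \<in> cspan ?D" for y
    using that
  proof (induction rule: complex_vector.span_induct_alt)
    case base
    have "V 0 = 0" "cadjoint J 0 = 0" "T 0 = 0"
      using lin[THEN clinear_diff, of 0 0] by simp_all
    then show ?case by simp
  next
    case (step c y z)
    then obtain n h where y: "y = (V ^^ n) (J h)" by blast
    have "cadjoint J (V y) = T (cadjoint J y)"
      using pow'[of "Suc n" h] pow'[of n h] by (simp add: y)
    with step(2) show ?case
      by (simp add: lin[THEN clinear_add] lin[THEN clinear_scaleC])
  qed
  have "x \<in> closure (cspan ?D)" unfolding dense by (rule UNIV_I)
  then obtain f where f: "\<And>n. f n \<in> cspan ?D" "f \<longlonglongrightarrow> x"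
    unfolding closure_sequential by metis
  show ?thesis
  proof (rule LIMSEQ_unique)
    show "(\<lambda>n. cadjoint J (V (f n))) \<longlonglongrightarrow> cadjoint J (V x)"
      by (rule bounded_clinear_tendsto[OF J' bounded_clinear_tendsto[OF V' f(2)]])
    show "(\<lambda>n. cadjoint J (V (f n))) \<longlonglongrightarrow> T (cadjoint J x)"
      unfolding span[OF f(1)]
      by (rule bounded_clinear_tendsto[OF T bounded_clinear_tendsto[OF J' f(2)]])
  qed
qed

theorem theorem4p3:
  fixes T1 T2 :: "'h::complex_hilbert_space \<Rightarrow> 'h"
    and q :: complex
    and \<iota>' :: "'h \<Rightarrow> 'k'::complex_hilbert_space"
    and V :: "'k' \<Rightarrow> 'k'"
    and \<iota> :: "'h \<Rightarrow> 'k::complex_hilbert_space"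
    and Vq :: "'k \<Rightarrow> 'k"
  assumes "contraction T1"
    and "T1 \<noteq> (\<lambda>h. 0)"
    and "bounded_clinear T2"
    and "\<And>h. T1 (T2 h) = q *\<^sub>C T2 (T1 h)"
    and "0 < cmod q" and "cmod q \<le> 1 / onorm T1"
    and "minimal_isometric_dilation \<iota>' V T1"
    and "bounded_clinear Vq"
    and "minimal_isometric_dilation \<iota> (\<lambda>x. q *\<^sub>C Vq x) (\<lambda>h. q *\<^sub>C T1 h)"
  shows "\<exists>W :: 'k \<Rightarrow> 'k'. bounded_clinear W \<and>
    (cadjoint W ` range \<iota>' \<subseteq> range \<iota> \<and>
      (\<forall>h. cadjoint W (\<iota>' h) = \<iota> (cadjoint T2 h))) \<and>
    onorm W = onorm T2 \<and>
    (\<forall>x. V (W x) = q *\<^sub>C W (Vq x))"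
proof -
  have T1: "bounded_clinear T1" using assms(1) by (simp add: contraction_def)
  note T2 = assms(3)
  have T1_lin: "clinear T1" and T2_lin: "clinear T2"
    using T1 T2 by (simp_all add: bounded_clinear_imp_clinear)
  have qT1: "bounded_clinear (\<lambda>h. q *\<^sub>C T1 h)"
    by (rule bounded_clinear_comp[OF bounded_clinear_scaleC T1])
  have \<iota>': "linear_isometry \<iota>'" and V: "linear_isometry V"
    using assms(7) by (simp_all add: minimal_isometric_dilation_def)
  have \<iota>: "linear_isometry \<iota>" and U: "linear_isometry (\<lambda>x. q *\<^sub>C Vq x)"
    using assms(9) by (simp_all add: minimal_isometric_dilation_def)
  have b\<iota>: "bounded_clinear \<iota>" and b\<iota>': "bounded_clinear \<iota>'"
    and n\<iota>: "\<And>h. norm (\<iota> h) = norm h"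
    using \<iota> \<iota>' by (simp_all add: linear_isometry_def)
  \<comment> \<open>\<open>T\<^sub>2\<close> preceded by the projection onto the copy of \<open>\<H>\<close>: it intertwines with the isometry itself.\<close>
  define Y where "Y x = T2 (cadjoint \<iota> x)" for x
  have Y: "clinear Y"
    unfolding Y_def
    by (rule bounded_clinear_imp_clinear[OF
          bounded_clinear_comp[OF T2 bounded_clinear_cadjoint[OF b\<iota>]]])
  have Y_bound: "norm (Y x) \<le> onorm T2 * norm x" for x
    using norm_le_onorm[OF T2, of "cadjoint \<iota> x"]
      mult_left_mono[OF norm_cadjoint_isometry_le[OF \<iota>, of x]
        onorm_pos_le[OF bounded_clinear_imp_bounded_linear[OF T2]]]
    by (simp add: Y_def)
  have T1Y: "T1 (Y x) = Y (q *\<^sub>C Vq x)" for x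
    using minimal_isometric_dilation_coextension[OF assms(9) qT1, of x]
    by (simp add: Y_def assms(4) clinear_scaleC[OF T2_lin])
  obtain W where W: "clinear W" "\<And>x. norm (W x) \<le> onorm T2 * norm x"
    "\<And>x. cadjoint \<iota>' (W x) = Y x" "\<And>x. V (W x) = W (q *\<^sub>C Vq x)"
    using lifting_to_isometric_dilation[OF V U \<iota>'
        minimal_isometric_dilation_coextension[OF assms(7) T1] Y Y_bound T1Y] by blast
  have bW: "bounded_clinear W" using W(1,2) by (rule bounded_clinearI)
  have adj: "cadjoint W (\<iota>' h) = \<iota> (cadjoint T2 h)" for h
  proof (rule cinner_ext)
    show "cinner x (cadjoint W (\<iota>' h)) = cinner x (\<iota> (cadjoint T2 h))" for x
    proof -
      have "cinner x (cadjoint W (\<iota>' h)) = cinner (T2 (cadjoint \<iota> x)) h"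
        by (simp add: cinner_cadjoint[OF bW, symmetric] cinner_cadjoint_left[OF b\<iota>', symmetric]
            W(3) Y_def)
      also have "\<dots> = cinner x (\<iota> (cadjoint T2 h))"
        by (simp add: cinner_cadjoint[OF T2] cinner_cadjoint_left[OF b\<iota>])
      finally show ?thesis .
    qed
  qed
  have "onorm W = onorm T2"
  proof (rule antisym)
    show "onorm W \<le> onorm T2"
      by (rule onorm_bound[OF onorm_pos_le[OF bounded_clinear_imp_bounded_linear[OF T2]] W(2)])
    show "onorm T2 \<le> onorm W"
    proof (rule onorm_bound[OF onorm_pos_le[OF bounded_clinear_imp_bounded_linear[OF bW]]])
      fix h
      have "T2 h = cadjoint \<iota>' (W (\<iota> h))"
        by (simp add: W(3) Y_def cadjoint_isometry[OF \<iota>])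
      then have "norm (T2 h) \<le> norm (W (\<iota> h))" using norm_cadjoint_isometry_le[OF \<iota>'] by simp
      also have "\<dots> \<le> onorm W * norm h"
        using norm_le_onorm[OF bW, of "\<iota> h"] by (simp add: n\<iota>)
      finally show "norm (T2 h) \<le> onorm W * norm h" .
    qed
  qed
  moreover have "V (W x) = q *\<^sub>C W (Vq x)" for x
    by (simp add: W(4) clinear_scaleC[OF W(1)])
  ultimately show ?thesis using bW adj by (intro exI[of _ W]) auto
qed

end
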